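(* For every integer $d\ge 1$ define column vectors $\mathbf{c}_d=(c(d,d),c(d,d-1),\dots,c(d,1),c(d,0))^{T}\in\mathbb{Q}^{d+1}$ by $\mathbf{c}_1=(1,1)^T$ and $$\mathbf{c}_d=M_{d-1}^{d}M_{d-2}^{d-1}\cdots M_2^3M_1^2\,\mathbf{c}_1\quad(d\ge 2),$$ where, for $e\ge 1$, $M_e^{e+1}$ is the $(e+2)\times(e+1)$ rational matrix whose rows are indexed (top to bottom) by $m=e+1,e,\dots,1,0$ and whose columns are indexed (left to right) by $p=e,e-1,\dots,1,0$, with entries - $(M_e^{e+1})_{m,p}=\dfrac{2}{m}$ if $m\ge 1$ and $p=m-1$; - $(M_e^{e+1})_{m,p}=\dfrac{2B_{p+1-m}}{p+1}\dbinom{p+1}{p+1-m}$ if $m\ge 1$ and $p\ge m+1$; - $(M_e^{e+1})_{0,0}=1$; - all other entries equal to $0$. Then for all integers $d\ge1$ and $n\ge 0$, $$|P_n^d|=\mathbf{c}_d\cdot\mathbf{n}_d=\sum_{p=0}^{d}c(d,p)\,n^p,\qquad \mathbf{n}_d=(n^d,n^{d-1},\dots,n,1)^T.$$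
   Context: For integers $d\ge 1$ and $n\ge 0$, let $e_1,\dots,e_d$ be the standard unit vectors of $\mathbb{Z}^d$ and let $P_n^d=\{X_1+X_2+\cdots+X_n : X_i\in\{\pm e_1,\dots,\pm e_d\}\text{ for } i=1,\dots,n\}\subseteq\mathbb{Z}^d$ be the set of possible positions of a nearest-neighbour walk in $\mathbb{Z}^d$ starting at the origin after exactly $n$ unit steps (so $P_0^d=\{0\}$); $|P_n^d|$ is its cardinality. $B_r$ denotes the $r$-th Bernoulli number, defined by $\frac{t}{e^t-1}=\sum_{r\ge0}B_r\frac{t^r}{r!}$ (only $B_r$ with $r\ge 2$ occur above, e.g. $B_2=1/6$, $B_3=0$). *)

theory Defs
  imports
    "HOL-Computational_Algebra.Formal_Power_Series"
    "Jordan_Normal_Form.Matrix"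
begin

(* The quotient is that of rat fps: as numerator and denominator both have subdegree 1,
   it is the exact power series t / (e^t - 1). *)
definition bernoulli :: "nat \<Rightarrow> rat" where
  "bernoulli r = fact r * fps_nth (fps_X / (fps_exp 1 - 1)) r"

definition unit_steps :: "nat \<Rightarrow> int vec set" where
  "unit_steps d = {unit_vec d i | i. i < d} \<union> {- unit_vec d i | i. i < d}"

definition walk_positions :: "nat \<Rightarrow> nat \<Rightarrow> int vec set" where
  "walk_positions d n =
     {finsum_vec TYPE(int) d X {1..n} | X. \<forall>i\<in>{1..n}. X i \<in> unit_steps d}"

definition step_entry :: "nat \<Rightarrow> nat \<Rightarrow> rat" where
  "step_entry m p =
     (if 1 \<le> m \<and> p = m - 1 then 2 / of_nat m
      else if 1 \<le> m \<and> m + 1 \<le> p then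
        2 * bernoulli (p + 1 - m) / of_nat (p + 1) * of_nat ((p + 1) choose (p + 1 - m))
      else if m = 0 \<and> p = 0 then 1
      else 0)"

(* Rows are labelled m = e+1, ..., 0 and columns p = e, ..., 0, in decreasing order,
   whereas matrix positions (i, j) count upwards from 0. *)
definition step_mat :: "nat \<Rightarrow> rat mat" where
  "step_mat e = mat (e + 2) (e + 1) (\<lambda>(i, j). step_entry (e + 1 - i) (e - j))"

(* step_prod k is the product of step_mat k, step_mat (k - 1), ..., step_mat 1, in this order;
   the empty product has the size matching the vector (1, 1). *)
primrec step_prod :: "nat \<Rightarrow> rat mat" where
  "step_prod 0 = 1\<^sub>m 2"
| "step_prod (Suc k) = step_mat (Suc k) * step_prod k"

(* Meaningful for d \<ge> 1 only. *)
definition walk_coeff_vec :: "nat \<Rightarrow> rat vec" where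
  "walk_coeff_vec d = step_prod (d - 1) *\<^sub>v vec_of_list [1, 1]"

definition walk_coeff :: "nat \<Rightarrow> nat \<Rightarrow> rat" where
  "walk_coeff d p = vec_index (walk_coeff_vec d) (d - p)"

(* (n^d, n^(d-1), ..., n, 1), with 0^0 = 1 *)
definition power_vec :: "nat \<Rightarrow> nat \<Rightarrow> rat vec" where
  "power_vec d n = vec (d + 1) (\<lambda>i. of_nat n ^ (d - i))"

end

theory Submission
  imports Defs
begin

text \<open>
  A walk of \<open>n\<close> steps can end exactly at the lattice points of \<open>l\<^sub>1\<close>-norm at most \<open>n\<close> and of the same
  parity as \<open>n\<close>. Slicing this set by the first coordinate \<open>k\<close>, which leaves \<open>n - \<bar>k\<bar>\<close> for the others,
  gives \<open>\<bar>P\<^sub>n\<^bsup>d+1\<^esup>\<bar> = \<bar>P\<^sub>n\<^bsup>d\<^esup>\<bar> + 2 \<Sum>\<^bsub>j<n\<^esub> \<bar>P\<^sub>j\<^bsup>d\<^esup>\<bar>\<close>. On polynomials in \<open>n\<close> this operator sends \<open>n\<^sup>p\<close> to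
  \<open>n\<^sup>p + 2 \<Sum>\<^bsub>j<n\<^esub> j\<^sup>p\<close>, and Faulhaber's formula identifies its matrix with the step matrix: the term
  with \<open>B\<^sub>1 = -1/2\<close> cancels \<open>n\<^sup>p\<close>, except for \<open>p = 0\<close>, where it is absent.
\<close>

section \<open>The l1 norm, parity balls and unit steps\<close>

definition l1_norm :: "int vec \<Rightarrow> int" where
  "l1_norm v = (\<Sum>i<dim_vec v. \<bar>v $ i\<bar>)"

definition parity_ball :: "nat \<Rightarrow> nat \<Rightarrow> int vec set" where
  "parity_ball d n = {v \<in> carrier_vec d. l1_norm v \<le> int n \<and> even (l1_norm v + int n)}"

lemma l1_norm_nonneg: "0 \<le> l1_norm v"
  by (simp add: l1_norm_def sum_nonneg)

lemma l1_norm_vCons [simp]: "l1_norm (vCons k v) = \<bar>k\<bar> + l1_norm v"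
  by (simp add: l1_norm_def sum.lessThan_Suc_shift del: sum.lessThan_Suc)

lemma l1_norm_eq_0_iff: "l1_norm v = 0 \<longleftrightarrow> (\<forall>i<dim_vec v. v $ i = 0)"
  by (auto simp: l1_norm_def sum_nonneg_eq_0_iff)

lemma l1_norm_add_unit:
  assumes "v \<in> carrier_vec d" and "i < d"
  shows "l1_norm (v + c \<cdot>\<^sub>v unit_vec d i) = l1_norm v - \<bar>v $ i\<bar> + \<bar>v $ i + c\<bar>"
proof -
  have "(\<Sum>j\<in>{..<d} - {i}. \<bar>(v + c \<cdot>\<^sub>v unit_vec d i) $ j\<bar>) = (\<Sum>j\<in>{..<d} - {i}. \<bar>v $ j\<bar>)"
    using assms by (intro sum.cong) auto
  moreover have "(v + c \<cdot>\<^sub>v unit_vec d i) $ i = v $ i + c"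
    using assms by simp
  ultimately show ?thesis
    using assms unfolding l1_norm_def by (simp add: sum.remove[of "{..<d}" i])
qed

text \<open>With both signs written as one scalar multiple, \<open>l1_norm_add_unit\<close> covers
  every step at once.\<close>

lemma unit_steps_eq: "unit_steps d = {c \<cdot>\<^sub>v unit_vec d i | c i. \<bar>c\<bar> = 1 \<and> i < d}"
proof -
  have abs_1: "\<bar>c\<bar> = 1 \<longleftrightarrow> c = 1 \<or> c = - 1" for c :: int by auto
  have "- unit_vec d i = (- 1 :: int) \<cdot>\<^sub>v unit_vec d i" for i by auto
  moreover have "unit_vec d i = (1 :: int) \<cdot>\<^sub>v unit_vec d i" for i by auto
  ultimately show ?thesis
    unfolding unit_steps_def abs_1 by (safe; metis)
qed

lemma unit_steps_carrier: "unit_steps d \<subseteq> carrier_vec d"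
  by (auto simp: unit_steps_def)

section \<open>Reachable positions form the parity ball\<close>

lemma walk_positions_0: "walk_positions d 0 = {0\<^sub>v d}"
  by (simp add: walk_positions_def finsum_vec_empty)

lemma finsum_vec_atLeastAtMost_Suc:
  fixes X :: "nat \<Rightarrow> int vec"
  assumes "\<forall>i\<in>{1..Suc n}. X i \<in> carrier_vec d"
  shows "finsum_vec TYPE(int) d X {1..Suc n} = finsum_vec TYPE(int) d X {1..n} + X (Suc n)"
proof -
  have "{1..Suc n} = insert (Suc n) {1..n}" by auto
  moreover have X: "X \<in> {1..n} \<rightarrow> carrier_vec d" "X (Suc n) \<in> carrier_vec d"
    using assms by auto
  ultimately show ?thesis
    using finsum_vec_insert[of "{1..n}" "Suc n" X d] finsum_vec_closed[OF X(1)]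
    by (simp add: comm_add_vec[of _ d])
qed

lemma finsum_vec_cong:
  fixes X Y :: "nat \<Rightarrow> int vec"
  assumes "finite A" and "\<forall>i\<in>A. X i = Y i" and "\<forall>i\<in>A. Y i \<in> carrier_vec d"
  shows "finsum_vec TYPE(int) d X A = finsum_vec TYPE(int) d Y A"
proof (rule eq_vecI)
  have "X \<in> A \<rightarrow> carrier_vec d" "Y \<in> A \<rightarrow> carrier_vec d" using assms by auto
  then have "finsum_vec TYPE(int) d X A \<in> carrier_vec d" "finsum_vec TYPE(int) d Y A \<in> carrier_vec d"
    by (blast intro: finsum_vec_closed)+
  then show "dim_vec (finsum_vec TYPE(int) d X A) = dim_vec (finsum_vec TYPE(int) d Y A)" by simp
  fix i assume "i < dim_vec (finsum_vec TYPE(int) d Y A)"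
  then have "i < d" using \<open>finsum_vec TYPE(int) d Y A \<in> carrier_vec d\<close> by simp
  then show "finsum_vec TYPE(int) d X A $ i = finsum_vec TYPE(int) d Y A $ i"
    using assms by (subst (1 2) index_finsum_vec) auto
qed

lemma walk_positions_Suc:
  "walk_positions d (Suc n) = {v + s | v s. v \<in> walk_positions d n \<and> s \<in> unit_steps d}"
proof (intro equalityI subsetI)
  fix w assume "w \<in> walk_positions d (Suc n)"
  then obtain X where X: "\<forall>i\<in>{1..Suc n}. X i \<in> unit_steps d"
    and w: "w = finsum_vec TYPE(int) d X {1..Suc n}"
    by (auto simp: walk_positions_def)
  have "w = finsum_vec TYPE(int) d X {1..n} + X (Suc n)"
    unfolding w using X unit_steps_carrier by (intro finsum_vec_atLeastAtMost_Suc) blast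
  with X show "w \<in> {v + s | v s. v \<in> walk_positions d n \<and> s \<in> unit_steps d}"
    unfolding walk_positions_def by fastforce
next
  fix w assume "w \<in> {v + s | v s. v \<in> walk_positions d n \<and> s \<in> unit_steps d}"
  then obtain X s where X: "\<forall>i\<in>{1..n}. X i \<in> unit_steps d" and s: "s \<in> unit_steps d"
    and w: "w = finsum_vec TYPE(int) d X {1..n} + s"
    by (auto simp: walk_positions_def)
  define Y where "Y = X(Suc n := s)"
  have Y: "\<forall>i\<in>{1..Suc n}. Y i \<in> unit_steps d"
    using X s by (auto simp: Y_def)
  have "finsum_vec TYPE(int) d Y {1..n} = finsum_vec TYPE(int) d X {1..n}"
    using X unit_steps_carrier by (intro finsum_vec_cong) (auto simp: Y_def)
  then have "w = finsum_vec TYPE(int) d Y {1..Suc n}"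
    using Y unit_steps_carrier[of d]
    by (subst finsum_vec_atLeastAtMost_Suc) (auto simp: w Y_def[symmetric] subset_iff, simp add: Y_def)
  with Y show "w \<in> walk_positions d (Suc n)"
    unfolding walk_positions_def by blast
qed

text \<open>A step moves one coordinate by one, so the norm changes by exactly one; both the bound
  and the parity condition survive.\<close>

lemma parity_ball_add_step:
  assumes "v \<in> parity_ball d n" and "s \<in> unit_steps d"
  shows "v + s \<in> parity_ball d (Suc n)"
proof -
  obtain c i where s: "s = c \<cdot>\<^sub>v unit_vec d i" and c: "\<bar>c\<bar> = 1" and i: "i < d"
    using assms(2) by (auto simp: unit_steps_eq)
  have v: "v \<in> carrier_vec d" "l1_norm v \<le> int n" "even (l1_norm v + int n)"
    using assms(1) by (auto simp: parity_ball_def)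
  have "\<bar>v $ i + c\<bar> = \<bar>v $ i\<bar> + 1 \<or> \<bar>v $ i + c\<bar> = \<bar>v $ i\<bar> - 1"
    using c by linarith
  then have "l1_norm (v + s) = l1_norm v + 1 \<or> l1_norm (v + s) = l1_norm v - 1"
    using l1_norm_add_unit[OF v(1) i, of c] by (auto simp: s)
  with v show ?thesis
    by (auto simp: parity_ball_def s)
qed

text \<open>The last step is undone by moving a nonzero coordinate of \<open>w\<close> towards 0.
  Only the origin has no such coordinate; there any step away will do.\<close>

lemma parity_ball_Suc_decompose:
  assumes "w \<in> parity_ball d (Suc n)" and "0 < d"
  obtains v s where "v \<in> parity_ball d n" "s \<in> unit_steps d" "w = v + s"
proof -
  have w: "w \<in> carrier_vec d" "l1_norm w \<le> int (Suc n)" "even (l1_norm w + int (Suc n))"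
    using assms(1) by (auto simp: parity_ball_def)
  obtain c i where c: "\<bar>c\<bar> = 1" and i: "i < d"
    and v: "l1_norm (w + (- c) \<cdot>\<^sub>v unit_vec d i) \<le> int n"
      "even (l1_norm (w + (- c) \<cdot>\<^sub>v unit_vec d i) + int n)"
  proof (cases "l1_norm w = 0")
    case True
    then have "w $ 0 = 0" using w(1) \<open>0 < d\<close> by (simp add: l1_norm_eq_0_iff)
    then have "l1_norm (w + (- 1) \<cdot>\<^sub>v unit_vec d 0) = 1"
      using l1_norm_add_unit[OF w(1) \<open>0 < d\<close>, of "- 1"] True by simp
    \<comment> \<open>The origin lies in the ball of radius \<open>Suc n\<close> only if that number
      is even. Hence n is odd, so at least 1, and the chosen predecessor of norm 1 fits both
      conditions.\<close>
    moreover have "odd n" using w(3) True by simp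
    moreover from this have "n \<ge> 1" by (cases n) auto
    ultimately show thesis using that[of 1 0] \<open>0 < d\<close> by simp
  next
    case False
    then obtain i where i: "i < d" "w $ i \<noteq> 0"
      using w(1) by (auto simp: l1_norm_eq_0_iff)
    have "\<bar>w $ i + (- sgn (w $ i))\<bar> = \<bar>w $ i\<bar> - 1"
      using i by (auto simp: sgn_if)
    then have "l1_norm (w + (- sgn (w $ i)) \<cdot>\<^sub>v unit_vec d i) = l1_norm w - 1"
      using l1_norm_add_unit[OF w(1) i(1), of "- sgn (w $ i)"] by simp
    then show thesis using that[of "sgn (w $ i)" i] i w by (simp add: abs_sgn_eq)
  qed
  show thesis
  proof
    show "w + (- c) \<cdot>\<^sub>v unit_vec d i \<in> parity_ball d n"
      using v w(1) by (simp add: parity_ball_def)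
    show "c \<cdot>\<^sub>v unit_vec d i \<in> unit_steps d"
      using c i by (auto simp: unit_steps_eq)
    show "w = w + (- c) \<cdot>\<^sub>v unit_vec d i + c \<cdot>\<^sub>v unit_vec d i"
      using w(1) by (intro eq_vecI) auto
  qed
qed

lemma walk_positions_eq_parity_ball:
  assumes "0 < d"
  shows "walk_positions d n = parity_ball d n"
proof (induction n)
  case 0
  have "l1_norm v \<le> 0 \<longleftrightarrow> v = 0\<^sub>v d" if "v \<in> carrier_vec d" for v
  proof -
    have "l1_norm v \<le> 0 \<longleftrightarrow> l1_norm v = 0" using l1_norm_nonneg[of v] by linarith
    also have "\<dots> \<longleftrightarrow> v = 0\<^sub>v d" using that by (auto simp: l1_norm_eq_0_iff)
    finally show ?thesis .
  qed
  moreover have "l1_norm (0\<^sub>v d) = 0" by (simp add: l1_norm_def)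
  ultimately show ?case
    by (auto simp: walk_positions_0 parity_ball_def)
next
  case (Suc n)
  show ?case
    unfolding walk_positions_Suc Suc
    using parity_ball_add_step parity_ball_Suc_decompose[OF _ assms] by blast
qed

section \<open>Slicing by the first coordinate and the counting recursion\<close>

lemma parity_ball_Suc_dim:
  "parity_ball (Suc d) n =
     case_prod vCons ` (SIGMA k:{- int n..int n}. parity_ball d (n - nat \<bar>k\<bar>))"
proof (intro equalityI subsetI)
  fix w assume "w \<in> parity_ball (Suc d) n"
  then obtain k v where w: "w = vCons k v" and v: "v \<in> carrier_vec d"
    "\<bar>k\<bar> + l1_norm v \<le> int n" "even (\<bar>k\<bar> + l1_norm v + int n)"
    by (cases w) (auto simp: parity_ball_def)
  \<comment> \<open>This bound makes the truncated subtraction in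
    \<open>n - nat \<bar>k\<bar>\<close> exact, so that parity carries over to the slice.\<close>
  have k: "\<bar>k\<bar> \<le> int n" using v(2) l1_norm_nonneg[of v] by linarith
  then have "v \<in> parity_ball d (n - nat \<bar>k\<bar>)"
    using v by (auto simp: parity_ball_def of_nat_diff nat_le_iff)
  moreover have "k \<in> {- int n..int n}" using k by auto
  ultimately show "w \<in> case_prod vCons ` (SIGMA k:{- int n..int n}. parity_ball d (n - nat \<bar>k\<bar>))"
    by (auto simp: w)
next
  fix w assume "w \<in> case_prod vCons ` (SIGMA k:{- int n..int n}. parity_ball d (n - nat \<bar>k\<bar>))"
  then obtain k v where w: "w = vCons k v" and k: "\<bar>k\<bar> \<le> int n"
    and v: "v \<in> parity_ball d (n - nat \<bar>k\<bar>)"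
    by auto
  then show "w \<in> parity_ball (Suc d) n"
    by (auto simp: parity_ball_def of_nat_diff nat_le_iff)
qed

text \<open>Walks and balls differ in dimension 0, where no steps exist. The slicing of balls is
  still valid there, so finiteness and the count for dimension 1 both start from this case.\<close>

lemma parity_ball_0_dim: "parity_ball 0 n = (if even n then {vNil} else {})"
proof -
  have "v \<in> parity_ball 0 n \<longleftrightarrow> v = vNil \<and> even n" for v
    by (auto simp: parity_ball_def l1_norm_def intro!: eq_vecI)
  then show ?thesis by auto
qed

lemma finite_parity_ball: "finite (parity_ball d n)"
  by (induction d arbitrary: n) (auto simp: parity_ball_0_dim parity_ball_Suc_dim)

text \<open>Each argument j < n arises from the two values k = n - j and k = j - n, and n itself
  only from k = 0.\<close>

lemma sum_symmetric_interval:
  fixes f :: "nat \<Rightarrow> 'a::comm_semiring_1"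
  shows "(\<Sum>k\<in>{- int n..int n}. f (n - nat \<bar>k\<bar>)) = f n + 2 * (\<Sum>j<n. f j)"
proof (induction n arbitrary: f)
  case 0
  then show ?case by simp
next
  case (Suc n)
  have "{- int (Suc n)..int (Suc n)} = {int (Suc n), - int (Suc n)} \<union> {- int n..int n}"
    by auto
  moreover have "{int (Suc n), - int (Suc n)} \<inter> {- int n..int n} = {}"
    by auto
  moreover have "(\<Sum>k\<in>{int (Suc n), - int (Suc n)}. f (Suc n - nat \<bar>k\<bar>)) = 2 * f 0"
    by (simp add: mult_2 del: of_nat_Suc sum_constant)
  ultimately have "(\<Sum>k\<in>{- int (Suc n)..int (Suc n)}. f (Suc n - nat \<bar>k\<bar>)) =
      2 * f 0 + (\<Sum>k\<in>{- int n..int n}. f (Suc n - nat \<bar>k\<bar>))"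
    by (simp only: sum.union_disjoint finite.intros finite_atLeastAtMost_int)
  \<comment> \<open>Away from the two new endpoints the argument of \<open>f\<close> is a successor,
    so the induction hypothesis is applied to the shifted function \<open>f\<close> after
    \<open>Suc\<close>.\<close>
  also have "(\<Sum>k\<in>{- int n..int n}. f (Suc n - nat \<bar>k\<bar>)) =
      (\<Sum>k\<in>{- int n..int n}. f (Suc (n - nat \<bar>k\<bar>)))"
    by (intro sum.cong refl arg_cong[of _ _ f]) (auto simp: Suc_diff_le nat_le_iff)
  also have "\<dots> = f (Suc n) + 2 * (\<Sum>j<n. f (Suc j))"
    by (rule Suc)
  finally show ?case
    by (simp add: sum.lessThan_Suc_shift algebra_simps del: sum.lessThan_Suc)
qed

lemma card_parity_ball_Suc_dim:
  "card (parity_ball (Suc d) n) = card (parity_ball d n) + 2 * (\<Sum>j<n. card (parity_ball d j))"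
proof -
  have "inj_on (case_prod vCons) (SIGMA k:{- int n..int n}. parity_ball d (n - nat \<bar>k\<bar>))"
    by (auto intro: inj_onI)
  then have "card (parity_ball (Suc d) n) =
      card (SIGMA k:{- int n..int n}. parity_ball d (n - nat \<bar>k\<bar>))"
    unfolding parity_ball_Suc_dim by (rule card_image)
  also have "\<dots> = (\<Sum>k\<in>{- int n..int n}. card (parity_ball d (n - nat \<bar>k\<bar>)))"
    by (simp add: finite_parity_ball)
  also have "\<dots> = card (parity_ball d n) + 2 * (\<Sum>j<n. card (parity_ball d j))"
    by (rule sum_symmetric_interval)
  finally show ?thesis .
qed

lemma card_parity_ball_1: "card (parity_ball 1 n) = n + 1"
proof -
  \<comment> \<open>The cardinalities in dimension 0 alternate 1, 0, 1, 0, ...\<close>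
  have "card (parity_ball 0 n) + 2 * (\<Sum>j<n. card (parity_ball 0 j)) = n + 1"
    by (induction n) (auto simp: parity_ball_0_dim)
  then show ?thesis
    using card_parity_ball_Suc_dim[of 0 n] by simp
qed

section \<open>Bernoulli numbers, Faulhaber's formula and the columns of the step matrix\<close>

lemma bernoulli_fps_mult:
  "fps_X / (fps_exp 1 - 1) * (fps_exp 1 - 1 :: rat fps) = fps_X"
proof -
  have "fps_nth (fps_exp 1 - 1 :: rat fps) 1 \<noteq> 0" by simp
  then have "fps_exp 1 - 1 \<noteq> (0 :: rat fps)" by (metis fps_zero_nth)
  moreover have "subdegree (fps_exp 1 - 1 :: rat fps) = 1"
    by (rule subdegreeI) auto
  ultimately have "(fps_exp 1 - 1 :: rat fps) dvd fps_X"
    by (subst fps_dvd_iff) auto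
  then show ?thesis by simp
qed

lemma bernoulli_0: "bernoulli 0 = 1" and bernoulli_1: "bernoulli 1 = - 1 / 2"
proof -
  define F :: "rat fps" where "F = fps_X / (fps_exp 1 - 1)"
  \<comment> \<open>As e^t - 1 has no constant term, the coefficient at k involves only those of
    \<open>F\<close> below k; k = 1 and k = 2 yield the two values.\<close>
  have eq: "fps_nth (F * (fps_exp 1 - 1)) k = fps_nth fps_X k" for k
    unfolding F_def bernoulli_fps_mult ..
  have 0: "fps_nth F 0 = 1"
    using eq[of 1] by (simp add: fps_mult_nth)
  moreover have "fps_nth F 1 = - 1 / 2"
    using eq[of 2] 0 by (simp add: fps_mult_nth numeral_2_eq_2)
  ultimately show "bernoulli 0 = 1" "bernoulli 1 = - 1 / 2"
    by (simp_all add: bernoulli_def F_def)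
qed

text \<open>Faulhaber's formula by generating functions: the geometric sum of e^(jt) over j < n,
  multiplied by t, equals t/(e^t - 1) times e^(nt) - 1. The coefficients of t^(p+1) are
  compared.\<close>

lemma sum_of_powers_bernoulli:
  "(\<Sum>j<n. of_nat j ^ p) =
     (\<Sum>k\<le>p. bernoulli k * of_nat (Suc p choose k) * of_nat n ^ (Suc p - k)) / of_nat (Suc p)"
proof -
  define F :: "rat fps" where "F = fps_X / (fps_exp 1 - 1)"
  have geometric: "(fps_exp 1 - 1) * (\<Sum>j<n. fps_exp (of_nat j)) = (fps_exp (of_nat n) - 1 :: rat fps)"
    by (induction n) (simp_all add: algebra_simps flip: fps_exp_add_mult)
  have "fps_X * (\<Sum>j<n. fps_exp (of_nat j)) = F * (fps_exp (of_nat n) - 1)"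
    unfolding geometric[symmetric] F_def mult.assoc[symmetric] bernoulli_fps_mult ..
  then have "fps_nth (fps_X * (\<Sum>j<n. fps_exp (of_nat j))) (Suc p) =
      fps_nth (F * (fps_exp (of_nat n) - 1)) (Suc p)" by simp
  also have "fps_nth (fps_X * (\<Sum>j<n. fps_exp (of_nat j))) (Suc p) = (\<Sum>j<n. of_nat j ^ p / fact p :: rat)"
    by (simp add: fps_sum_nth)
  \<comment> \<open>The convolution term k = p + 1 vanishes because e^(nt) - 1 has no constant
    term.\<close>
  also have "fps_nth (F * (fps_exp (of_nat n) - 1)) (Suc p) =
      (\<Sum>k\<le>p. fps_nth F k * of_nat n ^ (Suc p - k) / fact (Suc p - k))"
    by (simp add: fps_mult_nth atMost_atLeast0 Suc_diff_le del: fact_Suc power_Suc)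
  also have "\<dots> = (\<Sum>k\<le>p. bernoulli k * of_nat (Suc p choose k) * of_nat n ^ (Suc p - k) / fact (Suc p))"
  proof (rule sum.cong)
    fix k assume "k \<in> {..p}"
    then have "of_nat (Suc p choose k) = (fact (Suc p) / (fact k * fact (Suc p - k)) :: rat)"
      by (intro binomial_fact) auto
    then show "fps_nth F k * of_nat n ^ (Suc p - k) / fact (Suc p - k) =
        bernoulli k * of_nat (Suc p choose k) * of_nat n ^ (Suc p - k) / fact (Suc p)"
      by (simp add: bernoulli_def F_def del: fact_Suc)
  qed simp
  finally have "(\<Sum>j<n. of_nat j ^ p) / fact p =
      (\<Sum>k\<le>p. bernoulli k * of_nat (Suc p choose k) * of_nat n ^ (Suc p - k)) / (of_nat (Suc p) * fact p)"
    unfolding fact_Suc by (simp only: sum_divide_distrib)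
  then show ?thesis
    unfolding divide_divide_eq_left[symmetric] divide_cancel_right by simp
qed

text \<open>Column p lists the coefficients of the polynomial to which the counting operator sends
  n^p.\<close>

lemma step_entry_column_sum:
  assumes "p \<le> d"
  shows "(\<Sum>m\<le>Suc d. step_entry m p * of_nat n ^ m) = of_nat n ^ p + 2 * (\<Sum>j<n. of_nat j ^ p)"
proof -
  let ?x = "of_nat n :: rat"
  let ?t = "\<lambda>k. 2 * (bernoulli k * of_nat (Suc p choose k) * ?x ^ (Suc p - k)) / of_nat (Suc p)"
  \<comment> \<open>Here k = p + 1 - m is the Bernoulli index. For k = 1 the entry is on the
    diagonal and equals 0, while \<open>?t 1\<close> is -n^p; the correction makes up the
    difference.\<close>
  have entry: "step_entry (Suc p - k) p * ?x ^ (Suc p - k) = ?t k + (if k = 1 then ?x ^ p else 0)"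
    if "k \<le> p" for k
  proof -
    consider "k = 0" | "k = 1" | "k \<ge> 2" by linarith
    then show ?thesis
    proof cases
      case 3
      then have "Suc p - k \<ge> 1" "p \<noteq> Suc p - k - 1" "Suc p - k + 1 \<le> p" "p + 1 - (Suc p - k) = k"
        using that by auto
      then have "step_entry (Suc p - k) p = 2 * bernoulli k / of_nat (p + 1) * of_nat ((p + 1) choose k)"
        unfolding step_entry_def by auto
      then show ?thesis using 3 by simp
    qed (use that in \<open>simp_all add: step_entry_def bernoulli_0 bernoulli_1[simplified] divide_simps\<close>)
  qed
  have "(\<Sum>m\<le>Suc d. step_entry m p * ?x ^ m) = (\<Sum>m\<le>Suc p. step_entry m p * ?x ^ m)"
    using assms by (intro sum.mono_neutral_right) (auto simp: step_entry_def)
  also have "\<dots> = step_entry 0 p + (\<Sum>m\<le>p. step_entry (Suc m) p * ?x ^ Suc m)"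
    by (simp add: sum.atMost_Suc_shift del: sum.atMost_Suc power_Suc)
  also have "(\<Sum>m\<le>p. step_entry (Suc m) p * ?x ^ Suc m) =
      (\<Sum>k\<le>p. step_entry (Suc p - k) p * ?x ^ (Suc p - k))"
    by (rule sum.reindex_bij_witness[of _ "\<lambda>k. p - k" "\<lambda>m. p - m"]) (auto simp: Suc_diff_le)
  \<comment> \<open>For p = 0 the index k = 1 is out of range; the missing n^0 is then supplied by
    \<open>step_entry 0 0 = 1\<close>.\<close>
  also have "\<dots> = (\<Sum>k\<le>p. ?t k) + (if p = 0 then 0 else ?x ^ p)"
    by (simp add: entry sum.distrib)
  also have "(\<Sum>k\<le>p. ?t k) = 2 * (\<Sum>j<n. of_nat j ^ p)"
    unfolding sum_of_powers_bernoulli by (simp add: sum_divide_distrib sum_distrib_left)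
  finally show ?thesis
    by (simp add: step_entry_def)
qed

section \<open>Coefficient vectors and the polynomial count\<close>

lemma step_prod_carrier: "step_prod k \<in> carrier_mat (k + 2) 2"
  by (induction k) (auto simp: step_mat_def)

lemma dim_walk_coeff_vec: "d \<ge> 1 \<Longrightarrow> dim_vec (walk_coeff_vec d) = d + 1"
  using step_prod_carrier[of "d - 1"] by (auto simp: walk_coeff_vec_def)

lemma walk_coeff_vec_Suc:
  assumes "d \<ge> 1"
  shows "walk_coeff_vec (Suc d) = step_mat d *\<^sub>v walk_coeff_vec d"
proof -
  obtain k where d: "d = Suc k" using assms by (cases d) auto
  have "vec_of_list [1, 1 :: rat] \<in> carrier_vec 2"
    by (intro carrier_vecI) simp
  moreover have "step_mat (Suc k) \<in> carrier_mat (k + 3) (k + 2)"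
    by (simp add: step_mat_def numeral_3_eq_3)
  ultimately show ?thesis
    unfolding d walk_coeff_vec_def
    using assoc_mult_mat_vec[OF _ step_prod_carrier[of k]] by simp
qed

text \<open>Undoes the decreasing labels: summing over positions j becomes summing over exponents p
  = d - j.\<close>

lemma walk_coeff_Suc:
  assumes "d \<ge> 1" and "m \<le> Suc d"
  shows "walk_coeff (Suc d) m = (\<Sum>p\<le>d. step_entry m p * walk_coeff d p)"
proof -
  have "walk_coeff (Suc d) m = (\<Sum>j\<in>{0..<d + 1}. step_entry m (d - j) * walk_coeff_vec d $ j)"
    using assms dim_walk_coeff_vec[OF assms(1)]
    unfolding walk_coeff_def walk_coeff_vec_Suc[OF assms(1)]
    by (auto simp: step_mat_def scalar_prod_def intro!: sum.cong)
  also have "\<dots> = (\<Sum>p\<le>d. step_entry m p * walk_coeff d p)"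
    by (rule sum.reindex_bij_witness[of _ "\<lambda>k. d - k" "\<lambda>m. d - m"]) (auto simp: walk_coeff_def)
  finally show ?thesis .
qed

lemma scalar_prod_walk_coeff_power_vec:
  "walk_coeff_vec d \<bullet> power_vec d n = (\<Sum>p\<le>d. walk_coeff d p * of_nat n ^ p)"
proof -
  have "walk_coeff_vec d \<bullet> power_vec d n =
      (\<Sum>j\<in>{0..<d + 1}. walk_coeff_vec d $ j * of_nat n ^ (d - j))"
    by (simp add: scalar_prod_def power_vec_def)
  also have "\<dots> = (\<Sum>p\<le>d. walk_coeff d p * of_nat n ^ p)"
    by (rule sum.reindex_bij_witness[of _ "\<lambda>k. d - k" "\<lambda>m. d - m"]) (auto simp: walk_coeff_def)
  finally show ?thesis .
qed

text \<open>The coefficient recursion mirrors the counting recursion. The latter uses the ball of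
  radius n and all smaller ones, so the induction is over d with n arbitrary.\<close>

lemma card_parity_ball_polynomial:
  assumes "d \<ge> 1"
  shows "of_nat (card (parity_ball d n)) = (\<Sum>p\<le>d. walk_coeff d p * of_nat n ^ p)"
  using assms
proof (induction d arbitrary: n rule: dec_induct)
  case base
  have "walk_coeff_vec 1 = vec_of_list [1, 1]"
    unfolding walk_coeff_vec_def by (simp add: carrier_vecI numeral_2_eq_2)
  then have "walk_coeff 1 0 = 1" "walk_coeff 1 1 = 1"
    by (simp_all add: walk_coeff_def vec_index_vCons)
  then show ?case
    using card_parity_ball_1[of n] by simp
next
  case (step d)
  have "(\<Sum>m\<le>Suc d. walk_coeff (Suc d) m * of_nat n ^ m) =
      (\<Sum>m\<le>Suc d. \<Sum>p\<le>d. step_entry m p * walk_coeff d p * of_nat n ^ m)"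
    using step.hyps by (intro sum.cong refl) (simp add: walk_coeff_Suc sum_distrib_right)
  also have "\<dots> = (\<Sum>p\<le>d. walk_coeff d p * (\<Sum>m\<le>Suc d. step_entry m p * of_nat n ^ m))"
    \<comment> \<open>Exchanging the sums isolates the column sums of the step matrix.\<close>
    by (subst sum.swap) (simp add: sum_distrib_left mult_ac del: sum.atMost_Suc)
  also have "\<dots> = (\<Sum>p\<le>d. walk_coeff d p * (of_nat n ^ p + 2 * (\<Sum>j<n. of_nat j ^ p)))"
    by (intro sum.cong refl) (simp only: step_entry_column_sum atMost_iff)
  also have "\<dots> = (\<Sum>p\<le>d. walk_coeff d p * of_nat n ^ p) +
      2 * (\<Sum>j<n. \<Sum>p\<le>d. walk_coeff d p * of_nat j ^ p)"
    by (subst sum.swap) (simp add: sum.distrib sum_distrib_left algebra_simps)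
  also have "\<dots> = of_nat (card (parity_ball (Suc d) n))"
    by (simp add: card_parity_ball_Suc_dim flip: step.IH)
  finally show ?case ..
qed

theorem theorem1:
  fixes d n :: nat
  assumes "d \<ge> 1"
  shows "of_nat (card (walk_positions d n)) = walk_coeff_vec d \<bullet> power_vec d n
       \<and> walk_coeff_vec d \<bullet> power_vec d n = (\<Sum>p=0..d. walk_coeff d p * of_nat n ^ p)"
  using assms walk_positions_eq_parity_ball[of d n] card_parity_ball_polynomial[OF assms, of n]
  by (simp add: scalar_prod_walk_coeff_power_vec atMost_atLeast0)

end
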